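(* Fix $\gamma\ge1$ and let $$\Lambda=\Big\{\lambda\in\mathbb{C}:\ \operatorname{Re}\lambda\ge0,\ \operatorname{Re}\lambda+|\operatorname{Im}\lambda|\le\big(\sqrt\gamma+\tfrac12\big)^2\Big\}.$$ If $D^0$ is nonvanishing on $\Lambda$, then isentropic Navier–Stokes shocks are stable in the high-Mach number limit, i.e. there is $v_*>0$ such that the shock profile with parameter $v_+$ is stable for every $0<v_+<v_*$. Conversely, isentropic Navier–Stokes shocks are stable in the high-Mach number limit only if $D^0$ is nonvanishing on the interior of $\Lambda$.
   Context: Shocks and stability. The (rescaled) isentropic compressible Navier–Stokes equations with $\gamma$-law pressure are $v_t+v_x-u_x=0$, $u_t+u_x+(av^{-\gamma})_x=(u_x/v)_x$. For $0<v_+<1$ and $v_-=1$, let $a=v_+^{\gamma}\frac{1-v_+}{1-v_+^{\gamma}}$. The shock profile with parameter $v_+$ is the stationary solution $(\hat v,\hat u)(x)$ with $\hat v$ the (unique up to translation) monotone decreasing solution of $v'=v(v-1+a(v^{-\gamma}-1))$ with $\hat v(-\infty)=1$, $\hat v(+\infty)=v_+$, and $\hat u'=\hat v'$. The Mach number is $M=(\gamma a)^{-1/2}$, so the high-Mach number limit $M\to\infty$ corresponds to $v_+\to0$. With $h(\hat v)=-\hat v^{\gamma+1}+a(\gamma-1)+(a+1)\hat v^{\gamma}$, the linearized eigenvalue problem is $$\lambda v+v'-u'=0,\qquad \lambda u+u'-\Big(\frac{h(\hat v)}{\hat v^{\gamma+1}}v\Big)'=\Big(\frac{u'}{\hat v}\Big)'.$$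 The shock is called stable if it is spectrally stable: there is no $\lambda\ne0$ with $\operatorname{Re}\lambda\ge0$ for which this problem has a nontrivial solution $(v,u)$ decaying as $x\to\pm\infty$. Limiting Evans function. Let $\hat v_0(x)=\frac{1-\tanh(x/2)}{2}$ and $$A^0(x,\lambda)=\begin{pmatrix}0&\lambda&1\\0&0&1\\ \lambda\hat v_0&\lambda\hat v_0&2\hat v_0-1-\lambda\end{pmatrix}.$$ For $\operatorname{Re}\lambda\ge0$, the matrix $A^0(-\infty,\lambda)$ has the unique (simple) eigenvalue $\mu=\frac{1+\sqrt{1+4\lambda}}{2}$ of positive real part; let $V_1^{0-}(\lambda)$ be a corresponding nonzero eigenvector, analytic in $\lambda$, and let $W_1^{0-}$ be the solution of $W'=A^0W$ with $e^{-\mu x}W_1^{0-}(x)\to V_1^{0-}$ as $x\to-\infty$. Let $\widetilde W_1^{0+}$ be the unique solution of $\widetilde W'=-(A^0)^*\widetilde W$ ($^*$ conjugate transpose) with $\widetilde W_1^{0+}(x)\to(0,1,(1+\bar\lambda)^{-1})^T$ as $x\to+\infty$. Then $D^0(\lambda)=(\widetilde W_1^{0+})^*W_1^{0-}|_{x=0}$. *)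

theory Defs
  imports "HOL-Analysis.Analysis"
begin

definition pressure_coeff :: "real \<Rightarrow> real \<Rightarrow> real" where
  "pressure_coeff \<gamma> vp = vp powr \<gamma> * ((1 - vp) / (1 - vp powr \<gamma>))"

text \<open>The profile is determined only up to translation of \<open>x\<close> and an additive constant in the
  velocity, so it is a predicate; stability below quantifies over all representatives.\<close>

definition shock_profile :: "real \<Rightarrow> real \<Rightarrow> (real \<Rightarrow> real) \<Rightarrow> (real \<Rightarrow> real) \<Rightarrow> bool" where
  "shock_profile \<gamma> vp vh uh \<longleftrightarrow>
     (\<forall>x. (vh has_real_derivative
            vh x * (vh x - 1 + pressure_coeff \<gamma> vp * (vh x powr (- \<gamma>) - 1))) (at x)) \<and>
     (\<forall>x. (uh has_real_derivative deriv vh x) (at x)) \<and>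
     antimono vh \<and>
     (vh \<longlongrightarrow> 1) at_bot \<and>
     (vh \<longlongrightarrow> vp) at_top"

definition h_coeff :: "real \<Rightarrow> real \<Rightarrow> real \<Rightarrow> real" where
  "h_coeff \<gamma> vp w =
     - (w powr (\<gamma> + 1)) + pressure_coeff \<gamma> vp * (\<gamma> - 1) + (pressure_coeff \<gamma> vp + 1) * w powr \<gamma>"

text \<open>Classical solutions; \<open>p\<close> and \<open>q\<close> are the derivatives of the composite terms
  \<open>(h(vh) / vh^(\<gamma>+1)) v\<close> and \<open>u' / vh\<close>.\<close>

definition eigenvalue_problem ::
  "real \<Rightarrow> real \<Rightarrow> (real \<Rightarrow> real) \<Rightarrow> complex \<Rightarrow> (real \<Rightarrow> complex) \<Rightarrow> (real \<Rightarrow> complex) \<Rightarrow> bool" where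
  "eigenvalue_problem \<gamma> vp vh lam v u \<longleftrightarrow>
     (\<exists>v' u' p q.
        (\<forall>x. (v has_vector_derivative v' x) (at x)) \<and>
        (\<forall>x. (u has_vector_derivative u' x) (at x)) \<and>
        (\<forall>x. ((\<lambda>y. of_real (h_coeff \<gamma> vp (vh y) / vh y powr (\<gamma> + 1)) * v y)
               has_vector_derivative p x) (at x)) \<and>
        (\<forall>x. ((\<lambda>y. u' y / of_real (vh y)) has_vector_derivative q x) (at x)) \<and>
        (\<forall>x. lam * v x + v' x - u' x = 0) \<and>
        (\<forall>x. lam * u x + u' x - p x = q x))"

definition decaying :: "(real \<Rightarrow> complex) \<Rightarrow> bool" where
  "decaying f \<longleftrightarrow> (f \<longlongrightarrow> 0) at_bot \<and> (f \<longlongrightarrow> 0) at_top"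

definition spectrally_stable :: "real \<Rightarrow> real \<Rightarrow> (real \<Rightarrow> real) \<Rightarrow> bool" where
  "spectrally_stable \<gamma> vp vh \<longleftrightarrow>
     \<not> (\<exists>lam v u. lam \<noteq> 0 \<and> Re lam \<ge> 0 \<and> eigenvalue_problem \<gamma> vp vh lam v u \<and>
          decaying v \<and> decaying u \<and> (\<exists>x. v x \<noteq> 0 \<or> u x \<noteq> 0))"

definition stable_shock :: "real \<Rightarrow> real \<Rightarrow> bool" where
  "stable_shock \<gamma> vp \<longleftrightarrow> (\<forall>vh uh. shock_profile \<gamma> vp vh uh \<longrightarrow> spectrally_stable \<gamma> vp vh)"

definition stable_high_Mach :: "real \<Rightarrow> bool" where
  "stable_high_Mach \<gamma> \<longleftrightarrow> (\<exists>vstar>0. \<forall>vp. 0 < vp \<and> vp < vstar \<and> vp < 1 \<longrightarrow> stable_shock \<gamma> vp)"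

definition v0 :: "real \<Rightarrow> real" where
  "v0 x = (1 - tanh (x / 2)) / 2"

text \<open>The limiting coefficient matrix depends on \<open>x\<close> only through the value \<open>w\<close> of the limiting
  profile; \<open>w = 1\<close> gives its limit at minus infinity.\<close>

definition A0_of :: "complex \<Rightarrow> complex \<Rightarrow> complex^3^3" where
  "A0_of w lam = vector [vector [0, lam, 1],
                       vector [0, 0, 1],
                       vector [lam * w, lam * w, 2 * w - 1 - lam]]"

definition A0 :: "real \<Rightarrow> complex \<Rightarrow> complex^3^3" where
  "A0 x lam = A0_of (of_real (v0 x)) lam"

definition A0_minf :: "complex \<Rightarrow> complex^3^3" where
  "A0_minf lam = A0_of 1 lam"

lemma tendsto_A0_minf: "((\<lambda>x. A0 x lam) \<longlongrightarrow> A0_minf lam) at_bot"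
proof -
  have "filterlim (\<lambda>x::real. x / 2) at_bot at_bot"
    by (rule filterlim_tendsto_pos_mult_at_bot[where f="\<lambda>_. 1/2" and c="1/2", simplified])
       (auto simp: filterlim_ident)
  then have "((\<lambda>x::real. tanh (x / 2)) \<longlongrightarrow> -1) at_bot"
    by (rule filterlim_compose[OF tanh_real_at_bot])
  then have "(v0 \<longlongrightarrow> (1 - (-1)) / 2) at_bot"
    unfolding v0_def by (intro tendsto_intros) auto
  then have v0: "((\<lambda>x. complex_of_real (v0 x)) \<longlongrightarrow> 1) at_bot"
    using tendsto_of_real[of v0 1 at_bot, where 'a=complex] by simp
  have "((\<lambda>x. lam * complex_of_real (v0 x)) \<longlongrightarrow> lam) at_bot"
    using tendsto_mult_left[OF v0, of lam] by simp
  moreover have "((\<lambda>x. 2 * complex_of_real (v0 x) - 1 - lam) \<longlongrightarrow> 1 - lam) at_bot"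
    by (rule tendsto_eq_intros v0 refl | simp)+
  ultimately have "((\<lambda>x. A0_of (of_real (v0 x)) lam $ i $ j) \<longlongrightarrow> A0_of 1 lam $ i $ j) at_bot"
    for i j
    using exhaust_3[of i] exhaust_3[of j]
    by (elim disjE; hypsubst; simp add: A0_of_def vector_3)
  then show ?thesis
    unfolding A0_def A0_minf_def by (intro vec_tendstoI)
qed

definition conj_transpose :: "complex^'n^'m \<Rightarrow> complex^'m^'n" where
  "conj_transpose A = (\<chi> i j. cnj (A $ j $ i))"

definition mu :: "complex \<Rightarrow> complex" where
  "mu lam = (1 + csqrt (1 + 4 * lam)) / 2"

text \<open>The limiting Evans function depends on the choice of the analytic eigenvector \<open>V\<close>, hence is
  determined only up to a nonvanishing analytic factor, and only on the closed right half plane.\<close>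

definition limiting_Evans_function :: "(complex \<Rightarrow> complex) \<Rightarrow> bool" where
  "limiting_Evans_function D \<longleftrightarrow>
     (\<exists>(V :: complex \<Rightarrow> complex^3) (W :: complex \<Rightarrow> real \<Rightarrow> complex^3)
       (Wt :: complex \<Rightarrow> real \<Rightarrow> complex^3).
        (\<forall>i. (\<lambda>lam. V lam $ i) analytic_on {lam. Re lam \<ge> 0}) \<and>
        (\<forall>lam. Re lam \<ge> 0 \<longrightarrow>
           V lam \<noteq> 0 \<and> A0_minf lam *v V lam = mu lam *s V lam \<and>
           (\<forall>x. (W lam has_vector_derivative A0 x lam *v W lam x) (at x)) \<and>
           ((\<lambda>x. exp (- mu lam * of_real x) *s W lam x) \<longlongrightarrow> V lam) at_bot \<and>
           (\<forall>x. (Wt lam has_vector_derivative - (conj_transpose (A0 x lam) *v Wt lam x)) (at x)) \<and>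
           (Wt lam \<longlongrightarrow> vector [0, 1, inverse (1 + cnj lam)]) at_top \<and>
           D lam = (\<Sum>i\<in>UNIV. cnj (Wt lam 0 $ i) * W lam 0 $ i)))"

definition Lambda :: "real \<Rightarrow> complex set" where
  "Lambda \<gamma> = {lam. Re lam \<ge> 0 \<and> Re lam + \<bar>Im lam\<bar> \<le> (sqrt \<gamma> + 1 / 2)\<^sup>2}"

end

theory Submission
  imports Defs
begin

text \<open>The argument rests on the \<^emph>\<open>effective velocity\<close> \<open>w = u - (log v)\<^sub>x\<close>. In the variables
\<open>(v, w)\<close> the viscous term moves from the momentum equation into the mass equation:
\<open>v\<^sub>t + v\<^sub>x - w\<^sub>x = (v\<^sub>x / v)\<^sub>x\<close> and \<open>w\<^sub>t + w\<^sub>x + p(v)\<^sub>x = 0\<close>. Linearizing about a profile \<open>vh\<close>,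
passing to antiderivatives \<open>V\<close>, \<open>W\<close> of the perturbations, and putting \<open>\<sigma> = - 1 / p'(vh)\<close>, an
eigenfunction for \<open>\<lambda>\<close> satisfies
\<open>\<lambda> V + V' - W' = (V' / vh)'\<close> and \<open>\<sigma> (W' + \<lambda> W) = V'\<close>.
Multiply the first equation by the conjugate of \<open>V\<close>, the second by that of \<open>W\<close>, and take real
parts: the cross terms form a total derivative, and what remains is a sum of
\<open>Re \<lambda> \<bar>V\<bar>\<^sup>2\<close>, \<open>Re \<lambda> \<sigma> \<bar>W\<bar>\<^sup>2\<close>, \<open>\<bar>V'\<bar>\<^sup>2 / vh\<close> and \<open>- \<sigma>' \<bar>W\<bar>\<^sup>2 / 2\<close>. All four are nonnegative if
\<open>Re \<lambda> \<ge> 0\<close>, because the pressure is convex and the profile decreases, so that \<open>\<sigma>' \<le> 0\<close>. In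
pointwise form, a certain quadratic expression in \<open>(V, W, V' / vh)\<close> is nonincreasing; it tends to 0
at both ends, hence it is constant and \<open>V' = 0\<close>. This is the lemma
\<open>effective_velocity_energy\<close>, and it makes every shock profile stable, whatever its Mach number
(\<open>shock_profile_spectrally_stable\<close>).

The limiting system is the pressureless case. Let \<open>(U, V, V')\<close> be the solution that enters \<open>D\<^sup>0\<close>
from minus infinity. Its integrated effective velocity \<open>U - V' / v0\<close> solves \<open>Z' = - \<lambda> Z\<close> and decays
at minus infinity, so that it vanishes if \<open>Re \<lambda> > 0\<close>, and the energy identity applies with \<open>W = 0\<close>.
At plus infinity the decay of the energy must come from the Evans function: if \<open>D\<^sup>0(\<lambda>) = 0\<close>, then
the solution is orthogonal to the adjoint solution everywhere, which excludes the linearly growing mode of the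
degenerate end state \<open>v0 = 0\<close> and leaves \<open>U\<close> bounded with \<open>V \<rightarrow> 0\<close>
(\<open>limiting_system_decay_at_top\<close>). So \<open>D\<^sup>0\<close> has no zero with \<open>Re \<lambda> > 0\<close>
(\<open>limiting_Evans_function_nonzero\<close>), in particular none in the interior of \<open>\<Lambda>\<close>.\<close>

section \<open>Functions on the line that vanish at infinity\<close>

lemma nonincreasing_vanishing_derivative_zero:
  fixes F F' :: "real \<Rightarrow> real"
  assumes F: "\<And>x. (F has_real_derivative F' x) (at x)"
    and nonpos: "\<And>x. F' x \<le> 0"
    and lims: "(F \<longlongrightarrow> 0) at_bot" "(F \<longlongrightarrow> 0) at_top"
  shows "F' x = 0"
proof -
  have decr: "F b \<le> F a" if "a \<le> b" for a b
    using DERIV_nonpos_imp_nonincreasing[OF that] F nonpos by blast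
  have "F y \<le> 0" for y
    by (rule tendsto_lowerbound[OF lims(1)])
       (auto simp: eventually_at_bot_linorder intro!: exI[of _ y] decr)
  moreover have "F y \<ge> 0" for y
    by (rule tendsto_upperbound[OF lims(2)])
       (auto simp: eventually_at_top_linorder intro!: exI[of _ y] decr)
  ultimately have "F = (\<lambda>_. 0)"
    by (auto intro: antisym)
  with F[of x] show ?thesis
    using DERIV_unique[of F "F' x" x 0] by simp
qed

lemma vector_derivative_zero_imp_const:
  fixes f :: "real \<Rightarrow> 'a::real_normed_vector"
  assumes "\<And>x. (f has_vector_derivative 0) (at x)"
  shows "f x = f y"
  using has_derivative_zero_constant[of UNIV f] assms
  by (auto simp: has_vector_derivative_def)

lemma constant_vanishing_at_bot:
  fixes f :: "real \<Rightarrow> 'a::real_normed_vector"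
  assumes "\<And>x. (f has_vector_derivative 0) (at x)" and "(f \<longlongrightarrow> 0) at_bot"
  shows "f x = 0"
proof -
  have "(f \<longlongrightarrow> f x) at_bot"
    using vector_derivative_zero_imp_const[OF assms(1)]
    by (intro tendsto_eventually always_eventually) blast
  from tendsto_unique[OF _ this assms(2)] show ?thesis by simp
qed

lemma antimono_imp_derivative_nonpos:
  fixes f :: "real \<Rightarrow> real"
  assumes "antimono f" and "(f has_real_derivative D) (at x)"
  shows "D \<le> 0"
proof (rule ccontr)
  assume "\<not> D \<le> 0"
  then obtain d where d: "d > 0" "\<forall>h>0. h < d \<longrightarrow> f x < f (x + h)"
    using DERIV_pos_inc_right[OF assms(2)] by auto
  then have "f x < f (x + d / 2)" by simp
  moreover have "f (x + d / 2) \<le> f x"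
    using assms(1) d(1) by (auto simp: monotone_def)
  ultimately show False by simp
qed

text \<open>A Barbalat-type argument for either end of the line. A function that tends to 0 has somewhere in
each far unit interval a small slope \<open>m (g + e)\<close>, so \<open>g\<close> is small at that point; since \<open>g' \<rightarrow> 0\<close>, it
is then small on the whole interval. The window hypothesis is what \<open>at_top\<close> and \<open>at_bot\<close> share:
an eventual property holds eventually on whole intervals of length 1.\<close>

lemma slowly_varying_slope_vanishes:
  fixes r g g' e m :: "real \<Rightarrow> real"
  assumes window: "\<And>P. eventually P F \<Longrightarrow> eventually (\<lambda>x. \<forall>y\<in>{x..x + 1}. P y) F"
    and r: "\<And>x. (r has_real_derivative m x * (g x + e x)) (at x)"
    and g: "\<And>x. (g has_real_derivative g' x) (at x)"
    and m: "0 < m0" "\<And>x. m0 \<le> m x"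
    and lims: "(r \<longlongrightarrow> 0) F" "(e \<longlongrightarrow> 0) F" "(g' \<longlongrightarrow> 0) F"
  shows "(g \<longlongrightarrow> 0) F"
proof (rule tendstoI)
  fix eps :: real assume "eps > 0"
  \<comment> \<open>The final estimate is \<open>\<bar>g x\<bar> \<le> 2 d / m0 + 2 d\<close>; the 3 makes it strict.\<close>
  define d where "d = eps / (2 / m0 + 3)"
  have d: "d > 0" "d * (2 / m0 + 2) < eps"
    using \<open>eps > 0\<close> m(1) by (auto simp: d_def field_simps add_pos_pos)
  have "eventually (\<lambda>x. \<bar>r x\<bar> < d \<and> \<bar>e x\<bar> < d \<and> \<bar>g' x\<bar> < d) F"
    using lims[THEN tendstoD, OF d(1)] by (auto simp: eventually_conj_iff)
  from window[OF this] show "eventually (\<lambda>x. dist (g x) 0 < eps) F"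
  proof eventually_elim
    case (elim x)
    obtain z where z: "x < z" "z < x + 1" "r (x + 1) - r x = m z * (g z + e z)"
      using MVT2[of x "x + 1" r "\<lambda>x. m x * (g x + e x)"] r by auto
    obtain y where y: "x < y" "y < z" "g z - g x = (z - x) * g' y"
      using MVT2[of x z g g'] g z by auto
    have "\<bar>r (x + 1)\<bar> < d" "\<bar>r x\<bar> < d" using elim by auto
    then have "\<bar>m z * (g z + e z)\<bar> \<le> 2 * d" using z(3) by linarith
    moreover have "m0 * \<bar>g z + e z\<bar> \<le> m z * \<bar>g z + e z\<bar>"
      by (intro mult_right_mono m) auto
    moreover have "m z > 0" using m(1) m(2)[of z] by simp
    ultimately have "m0 * \<bar>g z + e z\<bar> \<le> 2 * d" by (simp add: abs_mult)
    then have 1: "\<bar>g z + e z\<bar> \<le> 2 * d / m0" using m(1) by (simp add: field_simps)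
    have 2: "\<bar>e z\<bar> < d" using elim z by auto
    have "\<bar>g' y\<bar> < d" using elim y z by auto
    then have "\<bar>g z - g x\<bar> \<le> 1 * d"
      unfolding y(3) abs_mult using z by (intro mult_mono) auto
    with 1 2 have "\<bar>g x\<bar> \<le> 2 * d / m0 + d + d" by linarith
    also have "\<dots> < eps" using d(2) by (simp add: algebra_simps)
    finally show ?case by simp
  qed
qed

lemma unit_window_at_top:
  assumes "eventually P (at_top :: real filter)"
  shows "eventually (\<lambda>x. \<forall>y\<in>{x..x + 1}. P y) at_top"
proof -
  obtain N where "\<forall>n\<ge>N. P n" using assms by (auto simp: eventually_at_top_linorder)
  then show ?thesis by (auto simp: eventually_at_top_linorder intro!: exI[of _ N])
qed

lemma unit_window_at_bot:
  assumes "eventually P (at_bot :: real filter)"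
  shows "eventually (\<lambda>x. \<forall>y\<in>{x..x + 1}. P y) at_bot"
proof -
  obtain N where "\<forall>n\<le>N. P n" using assms by (auto simp: eventually_at_bot_linorder)
  then show ?thesis by (auto simp: eventually_at_bot_linorder intro!: exI[of _ "N - 1"])
qed

section \<open>The energy identity for the effective velocity\<close>

text \<open>The energy identity behind both halves of the theorem, with \<open>Y = V' / vh\<close> and \<open>W\<close> the integrated
effective velocity. The transport equation \<open>\<sigma> (W' + \<lambda> W) = V'\<close> is required only after testing
against \<open>W\<close>: this admits the pressureless limit, in which \<open>\<sigma>\<close> would be infinite but \<open>W = 0\<close>.
The hypotheses on the limits concern \<open>F\<close> and not its separate terms, because in the limiting system \<open>Y\<close>
is merely bounded at plus infinity.\<close>

lemma effective_velocity_energy: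
  fixes V W W' Y :: "real \<Rightarrow> complex" and vh \<sigma> \<sigma>' :: "real \<Rightarrow> real" and lam :: complex
  defines "F \<equiv> \<lambda>x. (norm (V x))\<^sup>2 / 2 + \<sigma> x * (norm (W x))\<^sup>2 / 2 - V x \<bullet> W x - Y x \<bullet> V x"
  assumes lam: "Re lam \<ge> 0"
    and vh: "\<And>x. vh x > 0"
    and \<sigma>: "\<And>x. \<sigma> x \<ge> 0" "\<And>x. (\<sigma> has_real_derivative \<sigma>' x) (at x)" "\<And>x. \<sigma>' x \<le> 0"
    and V: "\<And>x. (V has_vector_derivative vh x *\<^sub>R Y x) (at x)"
    and W: "\<And>x. (W has_vector_derivative W' x) (at x)"
    and Y: "\<And>x. (Y has_vector_derivative lam * V x + vh x *\<^sub>R Y x - W' x) (at x)"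
    and transport: "\<And>x. W x \<bullet> (\<sigma> x *\<^sub>R (W' x + lam * W x) - vh x *\<^sub>R Y x) = 0"
    and lims: "(F \<longlongrightarrow> 0) at_bot" "(F \<longlongrightarrow> 0) at_top" "(V \<longlongrightarrow> 0) at_bot"
  shows "Y x = 0 \<and> V x = 0"
proof -
  define F' where "F' x = \<sigma>' x * (norm (W x))\<^sup>2 / 2 - Re lam * \<sigma> x * (norm (W x))\<^sup>2
      - Re lam * (norm (V x))\<^sup>2 - vh x * (norm (Y x))\<^sup>2" for x
  note inner_deriv = bounded_bilinear.has_vector_derivative[OF bounded_bilinear_inner]
  have F: "(F has_real_derivative F' x) (at x)" for x
  proof -
    note D = inner_deriv[OF V[of x] V[of x]] inner_deriv[OF W[of x] W[of x]]
      inner_deriv[OF V[of x] W[of x]] inner_deriv[OF Y[of x] V[of x]]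
    note D' = D[folded has_real_derivative_iff_has_vector_derivative]
    have "(F has_real_derivative
        (V x \<bullet> (vh x *\<^sub>R Y x) + (vh x *\<^sub>R Y x) \<bullet> V x) / 2
        + (\<sigma>' x * (W x \<bullet> W x) + (W x \<bullet> W' x + W' x \<bullet> W x) * \<sigma> x) / 2
        - (V x \<bullet> W' x + (vh x *\<^sub>R Y x) \<bullet> W x)
        - (Y x \<bullet> (vh x *\<^sub>R Y x) + (lam * V x + vh x *\<^sub>R Y x - W' x) \<bullet> V x)) (at x)"
      (is "(_ has_real_derivative ?E) _")
      unfolding F_def power2_norm_eq_inner
      by (intro DERIV_add DERIV_diff DERIV_cdivide DERIV_mult D' \<sigma>(2))
    \<comment> \<open>The cross terms with \<open>W'\<close> from the equation for \<open>Y\<close> cancel those of \<open>V \<bullet> W\<close>.\<close>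
    moreover have "?E = F' x"
      using transport[of x] unfolding F'_def power2_norm_eq_inner
      by (simp add: inner_complex_def algebra_simps) (simp add: field_simps)
    ultimately show ?thesis by simp
  qed
  have terms: "\<sigma>' x * (norm (W x))\<^sup>2 \<le> 0" "Re lam * \<sigma> x * (norm (W x))\<^sup>2 \<ge> 0"
     "Re lam * (norm (V x))\<^sup>2 \<ge> 0" "vh x * (norm (Y x))\<^sup>2 \<ge> 0" for x
    using lam \<sigma>(1,3)[of x] vh[of x] by (auto simp: mult_nonpos_nonneg)
  have "F' x \<le> 0" for x
    using terms[of x] unfolding F'_def by linarith
  from nonincreasing_vanishing_derivative_zero[OF F this lims(1,2)]
  have "vh x * (norm (Y x))\<^sup>2 = 0" for x
    using terms[of x] unfolding F'_def by (smt (verit) divide_nonpos_pos)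
  then have Y0: "Y x = 0" for x using vh[of x] by (metis less_irrefl mult_eq_0_iff norm_eq_zero power_not_zero)
  have "(V has_vector_derivative 0) (at x)" for x
    using V[of x] by (simp add: Y0)
  from constant_vanishing_at_bot[OF this lims(3)] have "V x = 0" .
  with Y0 show ?thesis by simp
qed

section \<open>Stability of every shock profile\<close>

lemma pressure_coeff_pos:
  assumes "\<gamma> > 0" "0 < vp" "vp < 1"
  shows "pressure_coeff \<gamma> vp > 0"
proof -
  have "vp powr \<gamma> < 1 powr \<gamma>" using assms by (intro powr_less_mono2) auto
  then show ?thesis using assms by (simp add: pressure_coeff_def)
qed

text \<open>The zeroth-order coefficient \<open>h / w powr (\<gamma> + 1)\<close> of the linearization combines the pressure term
\<open>- p'(w) = a \<gamma> / w powr (\<gamma> + 1)\<close> with the term \<open>- vh' / vh\<^sup>2\<close> that comes from linearizing the viscosity.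
Passing to the effective velocity removes the second one.\<close>

lemma h_coeff_eq_pressure_derivative:
  assumes "w > 0"
  shows "h_coeff \<gamma> vp w / w powr (\<gamma> + 1)
         + w * (w - 1 + pressure_coeff \<gamma> vp * (w powr (- \<gamma>) - 1)) / w\<^sup>2
       = pressure_coeff \<gamma> vp * \<gamma> / w powr (\<gamma> + 1)"
proof -
  have "w powr \<gamma> > 0" using assms by simp
  with assms show ?thesis
    unfolding h_coeff_def powr_minus powr_add
    by (simp add: field_simps power2_eq_square)
qed

lemma shock_profile_ge:
  assumes "shock_profile \<gamma> vp vh uh"
  shows "vp \<le> vh x"
proof (rule tendsto_upperbound)
  show "(vh \<longlongrightarrow> vp) at_top" using assms by (simp add: shock_profile_def)
  show "eventually (\<lambda>y. vh y \<le> vh x) at_top"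
    using assms by (auto simp: shock_profile_def monotone_def eventually_at_top_linorder intro!: exI[of _ x])
qed simp

text \<open>An eigenfunction is only assumed to tend to 0, while the energy also contains \<open>u'\<close>, through the
momentum flux \<open>g = u' / vh - u + c v\<close>. The momentum equation reads \<open>g' = \<lambda> u\<close>, so \<open>g\<close> varies slowly
and the decay of \<open>u\<close> forces that of \<open>g\<close>.\<close>

lemma decaying_eigenfunction_flux_vanishes:
  fixes vh c :: "real \<Rightarrow> real" and v u v' u' g :: "real \<Rightarrow> complex"
  assumes window: "\<And>P. eventually P F \<Longrightarrow> eventually (\<lambda>x. \<forall>y\<in>{x..x + 1}. P y) F"
    and vh: "0 < vp" "\<And>x. vp \<le> vh x"
    and u: "\<And>x. (u has_vector_derivative u' x) (at x)"
    and g: "\<And>x. (g has_vector_derivative lam * u x) (at x)"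
    and u': "\<And>x. u' x = vh x *\<^sub>R (g x + u x - c x *\<^sub>R v x)"
    and lims: "(u \<longlongrightarrow> 0) F" "(v \<longlongrightarrow> 0) F" "(c \<longlongrightarrow> c0) F"
  shows "(g \<longlongrightarrow> 0) F"
proof -
  have e: "((\<lambda>x. u x - c x *\<^sub>R v x) \<longlongrightarrow> 0) F"
    by (rule tendsto_eq_intros lims refl | simp)+
  have lu: "((\<lambda>x. lam * u x) \<longlongrightarrow> 0) F"
    by (rule tendsto_eq_intros lims refl | simp)+
  \<comment> \<open>The mean value theorem needs real functions: \<open>P\<close> is the real or the imaginary part.\<close>
  have "((\<lambda>x. P (g x)) \<longlongrightarrow> 0) F" if P: "bounded_linear P" for P :: "complex \<Rightarrow> real"
  proof (rule slowly_varying_slope_vanishes[OF window _ _ vh])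
    interpret bounded_linear P by fact
    show "((\<lambda>x. P (u x)) has_real_derivative vh x * (P (g x) + P (u x - c x *\<^sub>R v x))) (at x)" for x
      using has_vector_derivative[OF u[of x]]
      by (simp add: has_real_derivative_iff_has_vector_derivative u' scaleR add diff algebra_simps)
    show "((\<lambda>x. P (g x)) has_real_derivative P (lam * u x)) (at x)" for x
      using has_vector_derivative[OF g[of x]]
      by (simp add: has_real_derivative_iff_has_vector_derivative)
    show "((\<lambda>x. P (u x)) \<longlongrightarrow> 0) F" "((\<lambda>x. P (u x - c x *\<^sub>R v x)) \<longlongrightarrow> 0) F"
      "((\<lambda>x. P (lam * u x)) \<longlongrightarrow> 0) F"
      using tendsto[OF lims(1)] tendsto[OF e] tendsto[OF lu] by (simp_all add: zero)
  qed
  from this[OF bounded_linear_Re] this[OF bounded_linear_Im] show ?thesis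
    by (simp add: tendsto_complex_iff)
qed

text \<open>Since \<open>\<lambda> \<noteq> 0\<close>, the equations themselves provide decaying antiderivatives of the eigenfunction:
\<open>(u - v) / \<lambda>\<close> of \<open>v\<close> and \<open>g / \<lambda>\<close> of \<open>u\<close>. The weight \<open>\<sigma> = - 1 / p'(vh)\<close> turns the momentum equation
into the transport equation of the energy identity.\<close>

lemma shock_profile_spectrally_stable:
  assumes \<gamma>: "\<gamma> > 0" and vp: "0 < vp" "vp < 1" and profile: "shock_profile \<gamma> vp vh uh"
  shows "spectrally_stable \<gamma> vp vh"
  unfolding spectrally_stable_def
proof safe
  fix lam v u x
  assume lam: "lam \<noteq> 0" "Re lam \<ge> 0" and ev: "eigenvalue_problem \<gamma> vp vh lam v u"
    and dec: "decaying v" "decaying u"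
  define a where "a = pressure_coeff \<gamma> vp"
  have a: "a > 0" unfolding a_def using \<gamma> vp by (rule pressure_coeff_pos)
  define vh' where "vh' x = vh x * (vh x - 1 + a * (vh x powr (- \<gamma>) - 1))" for x
  have vh': "(vh has_real_derivative vh' x) (at x)" for x
    using profile by (simp add: shock_profile_def vh'_def a_def)
  have vh_ge: "vp \<le> vh x" for x by (rule shock_profile_ge[OF profile])
  have vh_pos: "vh x > 0" for x using vh_ge[of x] vp(1) by linarith
  have vh_lims: "(vh \<longlongrightarrow> 1) at_bot" "(vh \<longlongrightarrow> vp) at_top"
    using profile by (auto simp: shock_profile_def)
  define c where "c x = h_coeff \<gamma> vp (vh x) / vh x powr (\<gamma> + 1)" for x
  have c_lim: "(c \<longlongrightarrow> h_coeff \<gamma> vp w / w powr (\<gamma> + 1)) F" if "(vh \<longlongrightarrow> w) F" "w > 0" for w F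
    unfolding c_def h_coeff_def using that by (intro tendsto_intros) auto
  define \<sigma> where "\<sigma> x = vh x powr (\<gamma> + 1) / (a * \<gamma>)" for x
  have c_eq: "c x + vh' x / (vh x)\<^sup>2 = 1 / \<sigma> x" for x
    using h_coeff_eq_pressure_derivative[OF vh_pos[of x], of \<gamma> vp]
    unfolding c_def vh'_def \<sigma>_def a_def by simp
  obtain v' u' p q where
    v: "\<And>x. (v has_vector_derivative v' x) (at x)" and
    u: "\<And>x. (u has_vector_derivative u' x) (at x)" and
    p: "\<And>x. ((\<lambda>y. of_real (c y) * v y) has_vector_derivative p x) (at x)" and
    q: "\<And>x. ((\<lambda>y. u' y / of_real (vh y)) has_vector_derivative q x) (at x)" and
    mass: "\<And>x. lam * v x + v' x - u' x = 0" and
    momentum: "\<And>x. lam * u x + u' x - p x = q x"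
    using ev unfolding eigenvalue_problem_def c_def by blast
  define g where "g x = u' x / of_real (vh x) - u x + of_real (c x) * v x" for x
  have g: "(g has_vector_derivative lam * u x) (at x)" for x
  proof -
    have "(g has_vector_derivative q x - u' x + p x) (at x)"
      unfolding g_def
      by (intro has_vector_derivative_add has_vector_derivative_diff p q u)
    moreover have "q x - u' x + p x = lam * u x"
      using momentum[of x] by (simp add: algebra_simps)
    ultimately show ?thesis by simp
  qed
  have u'_eq: "u' x = vh x *\<^sub>R (g x + u x - c x *\<^sub>R v x)" for x
    using vh_pos[of x] by (simp add: g_def scaleR_conv_of_real field_simps)
  define V where "V x = (u x - v x) / lam" for x
  define Y where "Y x = (1 / vh x) *\<^sub>R v x" for x
  define Y' where "Y' x = (1 / vh x) *\<^sub>R v' x + (- (vh' x / (vh x)\<^sup>2)) *\<^sub>R v x" for x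
  \<comment> \<open>The effective velocity perturbation is \<open>u - (v / vh)'\<close>, with antiderivative \<open>g / \<lambda> - v / vh\<close>.\<close>
  define W where "W x = g x / lam - Y x" for x
  have Y: "(Y has_vector_derivative Y' x) (at x)" for x
  proof -
    have "((\<lambda>x. 1 / vh x) has_real_derivative - (vh' x / (vh x)\<^sup>2)) (at x)"
      using vh_pos[of x] by (auto intro!: derivative_eq_intros vh' simp: power2_eq_square)
    then show ?thesis unfolding Y_def Y'_def by (intro has_vector_derivative_scaleR v)
  qed
  have W: "(W has_vector_derivative u x - Y' x) (at x)" for x
    unfolding W_def
    by (rule has_vector_derivative_diff[OF
          has_vector_derivative_divide[OF g, of lam x, unfolded nonzero_mult_div_cancel_left[OF lam(1)]] Y])
  have vY: "vh x *\<^sub>R Y x = v x" for x using vh_pos[of x] by (simp add: Y_def)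
  have V: "(V has_vector_derivative vh x *\<^sub>R Y x) (at x)" for x
  proof -
    have "(V has_vector_derivative (u' x - v' x) / lam) (at x)"
      unfolding V_def by (intro has_vector_derivative_divide has_vector_derivative_diff u v)
    moreover have "u' x - v' x = lam * v x" using mass[of x] by (simp add: algebra_simps)
    ultimately show ?thesis using lam(1) by (simp add: vY)
  qed
  have transport: "\<sigma> x *\<^sub>R (u x - Y' x + lam * W x) = v x" for x
  proof -
    have s: "\<sigma> x > 0" using vh_pos[of x] a \<gamma> by (simp add: \<sigma>_def)
    have "u x - Y' x + lam * W x
        = (u' x - v' x - lam * v x) / of_real (vh x) + (c x + vh' x / (vh x)\<^sup>2) *\<^sub>R v x"
      using lam(1) vh_pos[of x]
      by (simp add: W_def Y_def Y'_def g_def scaleR_conv_of_real field_simps)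
    also have "u' x - v' x - lam * v x = 0" using mass[of x] by (simp add: algebra_simps)
    finally show ?thesis using s by (simp add: c_eq)
  qed
  have \<sigma>_deriv: "(\<sigma> has_real_derivative (\<gamma> + 1) * vh x powr \<gamma> * vh' x / (a * \<gamma>)) (at x)" for x
    unfolding \<sigma>_def using vh_pos[of x] a \<gamma>
    by (auto intro!: derivative_eq_intros vh')
  have vh'_nonpos: "vh' x \<le> 0" for x
    using antimono_imp_derivative_nonpos[OF _ vh'] profile by (auto simp: shock_profile_def)
  have zero: "Y x = 0 \<and> V x = 0" for x
  proof (rule effective_velocity_energy[OF lam(2) vh_pos _ \<sigma>_deriv _ V W])
    show "\<sigma> x \<ge> 0" for x using a \<gamma> by (simp add: \<sigma>_def)
    show "(\<gamma> + 1) * vh x powr \<gamma> * vh' x / (a * \<gamma>) \<le> 0" for x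
      using a \<gamma> vh'_nonpos[of x] by (intro divide_nonpos_pos mult_nonneg_nonpos) auto
    show "(Y has_vector_derivative lam * V x + vh x *\<^sub>R Y x - (u x - Y' x)) (at x)" for x
      using Y[of x] lam(1) by (simp add: vY V_def)
    show "W x \<bullet> (\<sigma> x *\<^sub>R (u x - Y' x + lam * W x) - vh x *\<^sub>R Y x) = 0" for x
      by (simp add: transport vY)
    have V_lim: "(V \<longlongrightarrow> 0) F" and
      energy_lim: "((\<lambda>x. (norm (V x))\<^sup>2 / 2 + \<sigma> x * (norm (W x))\<^sup>2 / 2 - V x \<bullet> W x - Y x \<bullet> V x) \<longlongrightarrow> 0) F"
      if window: "\<And>P. eventually P F \<Longrightarrow> eventually (\<lambda>x. \<forall>y\<in>{x..x + 1}. P y) F"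
        and lims: "(vh \<longlongrightarrow> w) F" "w > 0" "(v \<longlongrightarrow> 0) F" "(u \<longlongrightarrow> 0) F" for F w
    proof -
      have g_lim: "(g \<longlongrightarrow> 0) F"
        by (rule decaying_eigenfunction_flux_vanishes[OF window vp(1) vh_ge u g u'_eq lims(4,3) c_lim[OF lims(1,2)]])
      have Y_lim: "(Y \<longlongrightarrow> 0) F"
        unfolding Y_def using lims by (auto intro!: tendsto_eq_intros)
      have W_lim: "(W \<longlongrightarrow> 0) F"
        unfolding W_def using g_lim Y_lim lam(1) by (auto intro!: tendsto_eq_intros)
      show V_lim: "(V \<longlongrightarrow> 0) F"
        unfolding V_def using lims lam(1) by (auto intro!: tendsto_eq_intros)
      have \<sigma>_lim: "(\<sigma> \<longlongrightarrow> w powr (\<gamma> + 1) / (a * \<gamma>)) F"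
        unfolding \<sigma>_def using lims a \<gamma> by (intro tendsto_intros) auto
      show "((\<lambda>x. (norm (V x))\<^sup>2 / 2 + \<sigma> x * (norm (W x))\<^sup>2 / 2 - V x \<bullet> W x - Y x \<bullet> V x) \<longlongrightarrow> 0) F"
        by (rule tendsto_eq_intros V_lim W_lim Y_lim \<sigma>_lim refl | simp)+
    qed
    note dec' = dec[unfolded decaying_def]
    note bot = unit_window_at_bot vh_lims(1) zero_less_one dec'(1)[THEN conjunct1] dec'(2)[THEN conjunct1]
    note top = unit_window_at_top vh_lims(2) vp(1) dec'(1)[THEN conjunct2] dec'(2)[THEN conjunct2]
    show "(V \<longlongrightarrow> 0) at_bot" by (rule V_lim[OF bot])
    show "((\<lambda>x. (norm (V x))\<^sup>2 / 2 + \<sigma> x * (norm (W x))\<^sup>2 / 2 - V x \<bullet> W x - Y x \<bullet> V x) \<longlongrightarrow> 0) at_bot"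
      by (rule energy_lim[OF bot])
    show "((\<lambda>x. (norm (V x))\<^sup>2 / 2 + \<sigma> x * (norm (W x))\<^sup>2 / 2 - V x \<bullet> W x - Y x \<bullet> V x) \<longlongrightarrow> 0) at_top"
      by (rule energy_lim[OF top])
  qed
  have "v x = 0" for x using zero[of x] vY[of x] by simp
  moreover from this have "u x = 0" for x using zero[of x] lam(1) by (simp add: V_def)
  ultimately show "v x \<noteq> 0 \<Longrightarrow> False" "u x \<noteq> 0 \<Longrightarrow> False" by auto
qed

section \<open>The limiting profile\<close>

lemma v0_conv_exp: "v0 x = 1 / (1 + exp x)"
proof -
  define e where "e = exp (x / 2)"
  have e: "e > 0" "exp x = e * e" by (simp_all add: e_def flip: exp_add)
  have "tanh (x / 2) = ((e * e - 1) / e) / ((e * e + 1) / e)"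
    unfolding tanh_altdef exp_minus e_def[symmetric] using e(1) by (simp add: field_simps)
  then have "tanh (x / 2) = (e * e - 1) / (e * e + 1)" using e(1) by simp
  moreover have "e * e + 1 > 0" by (simp add: add_nonneg_pos)
  ultimately show ?thesis unfolding v0_def e(2) by (simp add: field_simps)
qed

lemma v0_pos: "v0 x > 0"
  by (simp add: v0_conv_exp add_pos_pos)

lemma v0_le_exp_minus: "v0 x \<le> exp (- x)"
  by (simp add: v0_conv_exp exp_minus field_simps add_pos_pos)

lemma has_real_derivative_v0: "(v0 has_real_derivative v0 x * (v0 x - 1)) (at x)"
proof -
  have nz: "1 + exp x > 0" by (simp add: add_pos_pos)
  have "((\<lambda>x. 1 / (1 + exp x)) has_real_derivative - exp x / (1 + exp x)\<^sup>2) (at x)"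
    using nz by (auto intro!: derivative_eq_intros simp: power2_eq_square)
  also have "- exp x / (1 + exp x)\<^sup>2 = v0 x * (v0 x - 1)"
    using nz by (simp add: v0_conv_exp field_simps power2_eq_square)
  finally show ?thesis by (simp add: v0_conv_exp[abs_def])
qed

lemma v0_at_bot: "(v0 \<longlongrightarrow> 1) at_bot"
  unfolding v0_conv_exp[abs_def] by (rule tendsto_eq_intros exp_at_bot refl | simp)+

lemma v0_at_top: "(v0 \<longlongrightarrow> 0) at_top"
proof (rule tendsto_sandwich[where f = "\<lambda>_. 0" and h = "\<lambda>x. exp (- x)"])
  show "((\<lambda>x. exp (- x)) \<longlongrightarrow> (0::real)) at_top"
    by (rule filterlim_compose[OF exp_at_bot filterlim_uminus_at_bot_at_top])
qed (auto simp: less_imp_le[OF v0_pos] v0_le_exp_minus)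

section \<open>Scalar equations with exponentially small coefficients\<close>

text \<open>Integration of the derivative bound from \<open>x\<close> to infinity; \<open>- K exp (- x)\<close> serves as the majorant
in the mean value inequality.\<close>

lemma vanishing_with_exp_small_derivative:
  fixes f f' :: "real \<Rightarrow> 'a::real_normed_vector"
  assumes f: "\<And>x. (f has_vector_derivative f' x) (at x)"
    and bound: "\<And>x. x \<ge> X \<Longrightarrow> norm (f' x) \<le> K * exp (- x)"
    and lim: "(f \<longlongrightarrow> 0) at_top" and x: "x \<ge> X"
  shows "norm (f x) \<le> K * exp (- x)"
proof -
  have "0 \<le> K * exp (- X)" using bound[of X] norm_ge_zero[of "f' X"] by linarith
  then have K: "K \<ge> 0" by (simp add: zero_le_mult_iff)
  have "norm (f y - f x) \<le> K * exp (- x)" if "y > x" for y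
  proof -
    have "norm (f y - f x) \<le> - K * exp (- y) - (- K * exp (- x))"
    proof (rule differentiable_bound_general[OF that])
      show "continuous_on {x..y} f"
        using f by (auto intro!: continuous_at_imp_continuous_on has_vector_derivative_continuous)
      show "continuous_on {x..y} (\<lambda>x. - K * exp (- x))" by (intro continuous_intros)
      show "((\<lambda>x. - K * exp (- x)) has_vector_derivative K * exp (- z)) (at z)" for z
        unfolding has_real_derivative_iff_has_vector_derivative[symmetric]
        by (auto intro!: derivative_eq_intros)
    qed (use f bound x in auto)
    moreover have "K * exp (- y) \<ge> 0" using K by simp
    ultimately show ?thesis by linarith
  qed
  then have ev: "eventually (\<lambda>y. norm (f y - f x) \<le> K * exp (- x)) at_top"
    by (auto simp: eventually_at_top_dense)
  have "((\<lambda>y. norm (f y - f x)) \<longlongrightarrow> norm (0 - f x)) at_top"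
    by (intro tendsto_intros lim)
  from tendsto_upperbound[OF this ev] show ?thesis by simp
qed

text \<open>Gronwall for an integrable rate: \<open>\<bar>f\<bar>\<^sup>2 exp (2 K exp (- x))\<close> is nonincreasing.\<close>

lemma bounded_solution_exp_small_rate:
  fixes f k :: "real \<Rightarrow> complex"
  assumes f: "\<And>x. x \<ge> X \<Longrightarrow> (f has_vector_derivative k x * f x) (at x)"
    and bound: "\<And>x. x \<ge> X \<Longrightarrow> norm (k x) \<le> K * exp (- x)"
  obtains M where "\<And>x. x \<ge> X \<Longrightarrow> norm (f x) \<le> M"
proof -
  define N where "N x = (f x \<bullet> f x) * exp (2 * K * exp (- x))" for x
  have "0 \<le> K * exp (- X)" using bound[of X] norm_ge_zero[of "k X"] by linarith
  then have K: "K \<ge> 0" by (simp add: zero_le_mult_iff)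
  have N_le: "N x \<le> N X" if "x \<ge> X" for x
  proof (rule DERIV_nonpos_imp_nonincreasing[OF that])
    fix y assume "X \<le> y" "y \<le> x"
    note D = bounded_bilinear.has_vector_derivative[OF bounded_bilinear_inner f f, OF \<open>X \<le> y\<close> \<open>X \<le> y\<close>,
        folded has_real_derivative_iff_has_vector_derivative]
    have "(N has_real_derivative
        (f y \<bullet> (k y * f y) + (k y * f y) \<bullet> f y - 2 * K * exp (- y) * (f y \<bullet> f y))
          * exp (2 * K * exp (- y))) (at y)"
      unfolding N_def by (auto intro!: derivative_eq_intros D simp: algebra_simps)
    moreover have "f y \<bullet> (k y * f y) + (k y * f y) \<bullet> f y = 2 * Re (k y) * (f y \<bullet> f y)"
      by (simp add: inner_complex_def algebra_simps)
    moreover have "2 * Re (k y) * (f y \<bullet> f y) \<le> 2 * K * exp (- y) * (f y \<bullet> f y)"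
      using bound[OF \<open>X \<le> y\<close>] complex_Re_le_cmod[of "k y"] by (intro mult_right_mono) auto
    ultimately show "\<exists>d. (N has_real_derivative d) (at y) \<and> d \<le> 0"
      by (intro exI[of _ "(f y \<bullet> (k y * f y) + (k y * f y) \<bullet> f y - 2 * K * exp (- y) * (f y \<bullet> f y))
          * exp (2 * K * exp (- y))"] conjI mult_nonpos_nonneg) auto
  qed
  have "norm (f x) \<le> sqrt (N X)" if "x \<ge> X" for x
  proof -
    have "exp (2 * K * exp (- x)) \<ge> 1" using K by simp
    from mult_left_mono[OF this inner_ge_zero[of "f x"]] have "f x \<bullet> f x \<le> N x"
      unfolding N_def by simp
    with N_le[OF that] show ?thesis
      by (intro real_le_rsqrt) (simp add: power2_norm_eq_inner)
  qed
  then show ?thesis by (rule that)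
qed

section \<open>Zeros of the limiting Evans function\<close>

text \<open>What a zero of the Evans function says about plus infinity. The coordinates \<open>(A, B, C)\<close> are the
conjugates of those of the adjoint solution, and the third coordinate \<open>V'\<close> of the forward solution is
already replaced by \<open>v0 U\<close>. Orthogonality then reads \<open>\<alpha> U + B V = 0\<close> with \<open>\<alpha> = A + v0 C\<close>. This
combination satisfies \<open>\<alpha>' = - v0 (\<alpha> + B)\<close>, so that it is of order \<open>exp (- x)\<close>; eliminating \<open>V\<close> from
\<open>U' = \<lambda> V + v0 U\<close> leaves a scalar equation with integrable coefficient, which has only bounded
solutions.\<close>

lemma limiting_system_decay_at_top:
  fixes A B C U V R :: "real \<Rightarrow> complex" and lam c0 :: complex
  assumes A: "\<And>x. (A has_vector_derivative - (lam * v0 x * C x)) (at x)"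
    and B: "\<And>x. (B has_vector_derivative - (lam * A x + lam * v0 x * C x)) (at x)"
    and C: "\<And>x. (C has_vector_derivative - (A x + B x + (2 * v0 x - 1 - lam) * C x)) (at x)"
    and adjoint_lims: "(A \<longlongrightarrow> 0) at_top" "(B \<longlongrightarrow> 1) at_top" "(C \<longlongrightarrow> c0) at_top"
    and U: "\<And>x. (U has_vector_derivative lam * V x + v0 x * U x) (at x)"
    and orthogonal: "\<And>x. A x * U x + B x * V x + C x * (v0 x * U x) = 0"
  shows "(V \<longlongrightarrow> 0) at_top \<and> (\<exists>X M. \<forall>x\<ge>X. norm (U x) \<le> M)"
proof -
  define \<alpha> where "\<alpha> x = A x + v0 x *\<^sub>R C x" for x
  have \<alpha>: "(\<alpha> has_vector_derivative - (v0 x *\<^sub>R (\<alpha> x + B x))) (at x)" for x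
  proof -
    have "(\<alpha> has_vector_derivative - (lam * v0 x * C x) +
       (v0 x *\<^sub>R (- (A x + B x + (2 * v0 x - 1 - lam) * C x)) + (v0 x * (v0 x - 1)) *\<^sub>R C x)) (at x)"
      unfolding \<alpha>_def
      by (intro has_vector_derivative_add has_vector_derivative_scaleR A C has_real_derivative_v0)
    moreover have "- (lam * v0 x * C x) +
       (v0 x *\<^sub>R (- (A x + B x + (2 * v0 x - 1 - lam) * C x)) + (v0 x * (v0 x - 1)) *\<^sub>R C x)
       = - (v0 x *\<^sub>R (\<alpha> x + B x))"
      by (simp add: \<alpha>_def scaleR_conv_of_real algebra_simps)
    ultimately show ?thesis by simp
  qed
  have \<alpha>_lim: "(\<alpha> \<longlongrightarrow> 0) at_top"
    unfolding \<alpha>_def by (rule tendsto_eq_intros adjoint_lims v0_at_top refl | simp)+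
  have "eventually (\<lambda>x. norm (\<alpha> x) < 1 \<and> norm (B x - 1) < 1 / 2) at_top"
    using tendstoD[OF \<alpha>_lim, of 1] tendstoD[OF adjoint_lims(2), of "1/2"]
    by (auto simp: eventually_conj_iff dist_norm)
  then obtain X where X: "\<And>x. x \<ge> X \<Longrightarrow> norm (\<alpha> x) < 1" "\<And>x. x \<ge> X \<Longrightarrow> norm (B x - 1) < 1 / 2"
    by (auto simp: eventually_at_top_linorder)
  have B_bounds: "norm (B x) \<ge> 1 / 2" "norm (B x) \<le> 3 / 2" if "x \<ge> X" for x
    using X(2)[OF that] norm_triangle_ineq3[of "B x" 1] by auto
  have \<alpha>_le: "norm (\<alpha> x) \<le> 3 * exp (- x)" if "x \<ge> X" for x
  proof (rule vanishing_with_exp_small_derivative[OF \<alpha> _ \<alpha>_lim that])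
    fix y assume y: "y \<ge> X"
    have "norm (\<alpha> y + B y) \<le> 3"
      using X(1)[OF y] B_bounds(2)[OF y] norm_triangle_ineq[of "\<alpha> y" "B y"] by linarith
    then have "v0 y * norm (\<alpha> y + B y) \<le> exp (- y) * 3"
      using v0_pos[of y] by (intro mult_mono v0_le_exp_minus) auto
    then show "norm (- (v0 y *\<^sub>R (\<alpha> y + B y))) \<le> 3 * exp (- y)"
      using v0_pos[of y] by (simp add: abs_of_pos)
  qed
  define k where "k x = \<alpha> x / B x" for x
  have k_le: "norm (k x) \<le> 6 * exp (- x)" if "x \<ge> X" for x
  proof -
    have "norm (\<alpha> x) / norm (B x) \<le> (3 * exp (- x)) / (1 / 2)"
      by (intro frac_le \<alpha>_le B_bounds that) auto
    then show ?thesis by (simp add: k_def norm_divide)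
  qed
  have V_eq: "V x = - k x * U x" if "x \<ge> X" for x
  proof -
    have "B x \<noteq> 0" using B_bounds(1)[OF that] by auto
    moreover have "B x * V x = - \<alpha> x * U x"
      using orthogonal[of x] unfolding \<alpha>_def scaleR_conv_of_real by algebra
    ultimately show ?thesis by (simp add: k_def field_simps)
  qed
  obtain M where M: "\<And>x. x \<ge> X \<Longrightarrow> norm (U x) \<le> M"
  proof (rule bounded_solution_exp_small_rate)
    fix x assume x: "x \<ge> X"
    show "(U has_vector_derivative (of_real (v0 x) - lam * k x) * U x) (at x)"
      using U[of x] by (simp add: V_eq[OF x] algebra_simps)
    have "norm (of_real (v0 x) - lam * k x) \<le> v0 x + norm lam * norm (k x)"
      using norm_triangle_ineq4[of "of_real (v0 x)" "lam * k x"] v0_pos[of x]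
      by (simp add: norm_mult)
    also have "\<dots> \<le> exp (- x) + norm lam * (6 * exp (- x))"
      by (intro add_mono mult_left_mono v0_le_exp_minus k_le x) auto
    finally show "norm (of_real (v0 x) - lam * k x) \<le> (1 + 6 * norm lam) * exp (- x)"
      by (simp add: algebra_simps)
  qed auto
  have "(V \<longlongrightarrow> 0) at_top"
  proof (rule Lim_null_comparison)
    show "eventually (\<lambda>x. norm (V x) \<le> 6 * exp (- x) * M) at_top"
      unfolding eventually_at_top_linorder
    proof (intro exI allI impI)
      fix x assume x: "x \<ge> X"
      have "norm (k x) * norm (U x) \<le> 6 * exp (- x) * M"
        by (intro mult_mono k_le M x) auto
      then show "norm (V x) \<le> 6 * exp (- x) * M" by (simp add: V_eq[OF x] norm_mult)
    qed
    have "((\<lambda>x. exp (- x)) \<longlongrightarrow> (0::real)) at_top"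
      by (rule filterlim_compose[OF exp_at_bot filterlim_uminus_at_bot_at_top])
    from tendsto_mult_right_zero[OF this, of "6 * M"]
    show "((\<lambda>x. 6 * exp (- x) * M) \<longlongrightarrow> 0) at_top"
      by (simp add: mult_ac)
  qed
  with M show ?thesis by blast
qed

text \<open>The solutions are multiples of \<open>exp (- \<lambda> x)\<close>, which is unbounded at minus infinity.\<close>

lemma exponential_solution_vanishes:
  fixes Z :: "real \<Rightarrow> complex"
  assumes Z: "\<And>x. (Z has_vector_derivative - lam * Z x) (at x)"
    and lim: "(Z \<longlongrightarrow> 0) at_bot" and lam: "Re lam > 0"
  shows "Z x = 0"
proof -
  have exp_deriv: "((\<lambda>x. exp (lam * of_real x)) has_vector_derivative lam * exp (lam * of_real x)) (at x)" for x
    by (rule has_vector_derivative_eq_rhs, rule has_vector_derivative_real_field)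
       (auto intro!: derivative_eq_intros)
  define E where "E x = exp (lam * of_real x) * Z x" for x
  have E_deriv: "(E has_vector_derivative 0) (at x)" for x
    using has_vector_derivative_mult[OF exp_deriv Z, of x]
    unfolding E_def by (simp add: algebra_simps)
  have "(E \<longlongrightarrow> 0) at_bot"
  proof (rule Lim_null_comparison)
    show "eventually (\<lambda>x. norm (E x) \<le> norm (Z x)) at_bot"
      using eventually_le_at_bot[of 0]
    proof eventually_elim
      case (elim x)
      then have "exp (Re lam * x) \<le> 1" using lam by (simp add: mult_nonneg_nonpos)
      then show ?case by (simp add: E_def norm_mult mult_left_le_one_le)
    qed
    show "((\<lambda>x. norm (Z x)) \<longlongrightarrow> 0) at_bot" using tendsto_norm_zero[OF lim] .
  qed
  from constant_vanishing_at_bot[OF E_deriv this] show ?thesis by (simp add: E_def)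
qed

lemma Re_mu_pos: "Re (mu lam) > 0"
  using Re_csqrt[of "1 + 4 * lam"] by (simp add: mu_def add_pos_nonneg)

text \<open>If \<open>D \<lambda> = 0\<close>, the energy identity forces the forward solution to vanish, contradicting its
nonzero leading coefficient \<open>V1\<close> at minus infinity.\<close>

lemma limiting_Evans_function_nonzero:
  assumes D: "limiting_Evans_function D" and lam: "Re lam > 0"
  shows "D lam \<noteq> 0"
proof
  assume D0: "D lam = 0"
  have "\<exists>(V1 :: complex^3) S T. V1 \<noteq> 0 \<and>
      (\<forall>x. (S has_vector_derivative A0 x lam *v S x) (at x)) \<and>
      ((\<lambda>x. exp (- mu lam * of_real x) *s S x) \<longlongrightarrow> V1) at_bot \<and>
      (\<forall>x. (T has_vector_derivative - (conj_transpose (A0 x lam) *v T x)) (at x)) \<and>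
      (T \<longlongrightarrow> vector [0, 1, inverse (1 + cnj lam)]) at_top \<and>
      D lam = (\<Sum>i\<in>UNIV. cnj (T 0 $ i) * S 0 $ i)"
    using D unfolding limiting_Evans_function_def
    by - (elim exE conjE, drule spec[of _ lam], drule mp[OF _ less_imp_le[OF lam]],
          elim conjE, intro exI conjI, assumption+)
  then obtain V1 :: "complex^3" and S T :: "real \<Rightarrow> complex^3" where
    V1: "V1 \<noteq> 0" and
    S: "\<And>x. (S has_vector_derivative A0 x lam *v S x) (at x)" and
    S_lim: "((\<lambda>x. exp (- mu lam * of_real x) *s S x) \<longlongrightarrow> V1) at_bot" and
    T: "\<And>x. (T has_vector_derivative - (conj_transpose (A0 x lam) *v T x)) (at x)" and
    T_lim: "(T \<longlongrightarrow> vector [0, 1, inverse (1 + cnj lam)]) at_top" and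
    D_eq: "D lam = (\<Sum>i\<in>UNIV. cnj (T 0 $ i) * S 0 $ i)"
    by blast
  note matrix_simps = A0_def A0_of_def conj_transpose_def matrix_vector_mult_def sum_3 vector_3
  define U V R where "U = (\<lambda>x. S x $ 1)" and "V = (\<lambda>x. S x $ 2)" and "R = (\<lambda>x. S x $ 3)"
  define A B C where "A = (\<lambda>x. cnj (T x $ 1))" and "B = (\<lambda>x. cnj (T x $ 2))" and "C = (\<lambda>x. cnj (T x $ 3))"
  have comp: "((\<lambda>x. S x $ i) has_vector_derivative (A0 x lam *v S x) $ i) (at x)" for i x
    by (rule bounded_linear.has_vector_derivative[OF bounded_linear_vec_nth S])
  have U: "(U has_vector_derivative lam * V x + R x) (at x)" for x
    using comp[of 1 x] by (simp add: matrix_simps U_def V_def R_def)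
  have V: "(V has_vector_derivative R x) (at x)" for x
    using comp[of 2 x] by (simp add: matrix_simps V_def R_def)
  have R: "(R has_vector_derivative lam * v0 x * (U x + V x) + (2 * v0 x - 1 - lam) * R x) (at x)" for x
    using comp[of 3 x] by (simp add: matrix_simps U_def V_def R_def algebra_simps)
  have comp': "((\<lambda>x. cnj (T x $ i)) has_vector_derivative
      cnj ((- (conj_transpose (A0 x lam) *v T x)) $ i)) (at x)" for i x
    by (rule bounded_linear.has_vector_derivative[OF bounded_linear_cnj],
        rule bounded_linear.has_vector_derivative[OF bounded_linear_vec_nth T])
  have A: "(A has_vector_derivative - (lam * v0 x * C x)) (at x)" for x
    using comp'[of 1 x] by (simp add: matrix_simps A_def B_def C_def)
  have B: "(B has_vector_derivative - (lam * A x + lam * v0 x * C x)) (at x)" for x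
    using comp'[of 2 x] by (simp add: matrix_simps A_def B_def C_def algebra_simps)
  have C: "(C has_vector_derivative - (A x + B x + (2 * v0 x - 1 - lam) * C x)) (at x)" for x
    using comp'[of 3 x] by (simp add: matrix_simps A_def B_def C_def algebra_simps)

  \<comment> \<open>The pairing of a solution with an adjoint solution is constant; at 0 it is \<open>D \<lambda>\<close>.\<close>
  have "A x * U x + B x * V x + C x * R x = A 0 * U 0 + B 0 * V 0 + C 0 * R 0" for x
  proof (rule vector_derivative_zero_imp_const[where f = "\<lambda>x. A x * U x + B x * V x + C x * R x"])
    show "((\<lambda>x. A x * U x + B x * V x + C x * R x) has_vector_derivative 0) (at x)" for x
      using has_vector_derivative_add[OF has_vector_derivative_add[OF
            has_vector_derivative_mult[OF A U] has_vector_derivative_mult[OF B V]]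
            has_vector_derivative_mult[OF C R], of x]
      by (simp add: algebra_simps)
  qed
  moreover have "A 0 * U 0 + B 0 * V 0 + C 0 * R 0 = 0"
    using D0 D_eq by (simp add: sum_3 A_def B_def C_def U_def V_def R_def)
  ultimately have pairing: "A x * U x + B x * V x + C x * R x = 0" for x by simp

  have S_bot: "((\<lambda>x. S x $ i) \<longlongrightarrow> 0) at_bot" for i
  proof -
    have "((\<lambda>x. exp (Re (mu lam) * x)) \<longlongrightarrow> 0) at_bot"
      using Re_mu_pos[of lam]
      by (intro filterlim_compose[OF exp_at_bot]
            filterlim_tendsto_pos_mult_at_bot[OF tendsto_const _ filterlim_ident])
    then have "((\<lambda>x. exp (mu lam * of_real x)) \<longlongrightarrow> 0) at_bot"
      by (subst tendsto_norm_zero_iff[symmetric]) simp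
    from tendsto_mult[OF this tendsto_vec_nth[OF S_lim, of i]]
    show ?thesis by (simp add: exp_minus field_simps)
  qed
  have bot: "(U \<longlongrightarrow> 0) at_bot" "(V \<longlongrightarrow> 0) at_bot" "(R \<longlongrightarrow> 0) at_bot"
    using S_bot by (simp_all add: U_def V_def R_def)

  \<comment> \<open>\<open>U - Y\<close> is the integrated effective velocity; it solves \<open>Z' = - \<lambda> Z\<close>.\<close>
  define Y where "Y x = (1 / v0 x) *\<^sub>R R x" for x
  have R_eq: "R x = v0 x *\<^sub>R Y x" for x using v0_pos[of x] by (simp add: Y_def)
  have "U x - Y x = 0" for x
  proof (rule exponential_solution_vanishes[where Z = "\<lambda>x. U x - Y x", OF _ _ lam])
    show "((\<lambda>x. U x - Y x) has_vector_derivative - lam * (U x - Y x)) (at x)" for x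
    proof -
      have "((\<lambda>x. 1 / v0 x) has_real_derivative - ((v0 x - 1) / v0 x)) (at x)"
        using v0_pos[of x] by (auto intro!: derivative_eq_intros has_real_derivative_v0)
      then have "(Y has_vector_derivative
          (1 / v0 x) *\<^sub>R (lam * v0 x * (U x + V x) + (2 * v0 x - 1 - lam) * R x)
          + (- ((v0 x - 1) / v0 x)) *\<^sub>R R x) (at x)"
        unfolding Y_def by (intro has_vector_derivative_scaleR R)
      moreover have "(1 / v0 x) *\<^sub>R (lam * v0 x * (U x + V x) + (2 * v0 x - 1 - lam) * R x)
          + (- ((v0 x - 1) / v0 x)) *\<^sub>R R x = lam * (U x + V x) + R x - lam * Y x"
        using v0_pos[of x] by (simp add: Y_def scaleR_conv_of_real field_simps)
      ultimately have "(Y has_vector_derivative lam * (U x + V x) + R x - lam * Y x) (at x)"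
        by simp
      from has_vector_derivative_diff[OF U this] show ?thesis by (simp add: algebra_simps)
    qed
    show "((\<lambda>x. U x - Y x) \<longlongrightarrow> 0) at_bot"
      unfolding Y_def using bot v0_at_bot by (auto intro!: tendsto_eq_intros)
  qed
  then have Y_eq: "Y = U" by auto

  have T_top: "((\<lambda>x. cnj (T x $ i)) \<longlongrightarrow> cnj (vector [0, 1, inverse (1 + cnj lam)] $ i)) at_top" for i
    by (intro tendsto_intros T_lim)
  have top: "(A \<longlongrightarrow> 0) at_top" "(B \<longlongrightarrow> 1) at_top" "(C \<longlongrightarrow> inverse (1 + lam)) at_top"
    using T_top[of 1] T_top[of 2] T_top[of 3] by (simp_all add: A_def B_def C_def vector_3)
  have "(V \<longlongrightarrow> 0) at_top \<and> (\<exists>X M. \<forall>x\<ge>X. norm (U x) \<le> M)"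
  proof (rule limiting_system_decay_at_top[OF A B C top])
    show "(U has_vector_derivative lam * V x + v0 x * U x) (at x)" for x
      using U[of x] R_eq[of x] by (simp add: Y_eq scaleR_conv_of_real)
    show "A x * U x + B x * V x + C x * (v0 x * U x) = 0" for x
      using pairing[of x] R_eq[of x] by (simp add: Y_eq scaleR_conv_of_real)
  qed
  then obtain X M where V_top: "(V \<longlongrightarrow> 0) at_top" and M: "\<And>x. x \<ge> X \<Longrightarrow> norm (U x) \<le> M"
    by blast
  have UV_top: "((\<lambda>x. U x \<bullet> V x) \<longlongrightarrow> 0) at_top"
  proof (rule Lim_null_comparison)
    show "eventually (\<lambda>x. norm (U x \<bullet> V x) \<le> M * norm (V x)) at_top"
      unfolding eventually_at_top_linorder
    proof (intro exI allI impI)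
      fix x assume "x \<ge> X"
      then show "norm (U x \<bullet> V x) \<le> M * norm (V x)"
        using Cauchy_Schwarz_ineq2[of "U x" "V x"] mult_right_mono[OF M, of x "norm (V x)"] by simp
    qed
    show "((\<lambda>x. M * norm (V x)) \<longlongrightarrow> 0) at_top"
      using tendsto_mult_right_zero[OF tendsto_norm_zero[OF V_top]] .
  qed

  have UV: "U x = 0 \<and> V x = 0" for x
  proof (rule effective_velocity_energy[where V = V and Y = U and vh = v0
        and W = "\<lambda>_. 0" and W' = "\<lambda>_. 0" and \<sigma> = "\<lambda>_. 1" and \<sigma>' = "\<lambda>_. 0"])
    show "(V has_vector_derivative v0 x *\<^sub>R U x) (at x)" for x
      using V[of x] R_eq[of x] by (simp add: Y_eq)
    show "(U has_vector_derivative lam * V x + v0 x *\<^sub>R U x - 0) (at x)" for x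
      using U[of x] R_eq[of x] by (simp add: Y_eq)
    show "((\<lambda>x. (norm (V x))\<^sup>2 / 2 + 1 * (norm (0::complex))\<^sup>2 / 2 - V x \<bullet> 0 - U x \<bullet> V x) \<longlongrightarrow> 0) at_bot"
      by (rule tendsto_eq_intros bot refl | simp)+
    show "((\<lambda>x. (norm (V x))\<^sup>2 / 2 + 1 * (norm (0::complex))\<^sup>2 / 2 - V x \<bullet> 0 - U x \<bullet> V x) \<longlongrightarrow> 0) at_top"
      by (rule tendsto_eq_intros V_top UV_top refl | simp)+
  qed (use lam bot v0_pos in auto)
  have "S x = 0" for x
    using UV[of x] R_eq[of x] by (simp add: vec_eq_iff forall_3 Y_eq U_def V_def R_def)
  then have "((\<lambda>_::real. 0) \<longlongrightarrow> V1) at_bot" using S_lim by simp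
  then show False using V1 by (simp add: tendsto_const_iff)
qed

section \<open>Stability in the high-Mach number limit\<close>

lemma interior_Lambda_subset: "interior (Lambda \<gamma>) \<subseteq> {lam. Re lam > 0}"
proof -
  have "interior (Lambda \<gamma>) \<subseteq> interior {lam. (1::complex) \<bullet> lam \<ge> 0}"
    by (rule interior_mono) (auto simp: Lambda_def inner_complex_def)
  also have "\<dots> = {lam. Re lam > 0}"
    by (subst interior_halfspace_ge) (auto simp: inner_complex_def)
  finally show ?thesis .
qed

theorem corollary2:
  fixes \<gamma> :: real and D0 :: "complex \<Rightarrow> complex"
  assumes "\<gamma> \<ge> 1"
    and "limiting_Evans_function D0"
  shows "((\<forall>lam\<in>Lambda \<gamma>. D0 lam \<noteq> 0) \<longrightarrow> stable_high_Mach \<gamma>) \<and>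
         (stable_high_Mach \<gamma> \<longrightarrow> (\<forall>lam\<in>interior (Lambda \<gamma>). D0 lam \<noteq> 0))"
proof -
  have "stable_shock \<gamma> vp" if "0 < vp" "vp < 1" for vp
    unfolding stable_shock_def using shock_profile_spectrally_stable that assms(1) by auto
  then have "stable_high_Mach \<gamma>"
    unfolding stable_high_Mach_def by (auto intro: exI[of _ 1])
  moreover have "D0 lam \<noteq> 0" if "lam \<in> interior (Lambda \<gamma>)" for lam
    using limiting_Evans_function_nonzero[OF assms(2)] interior_Lambda_subset that by blast
  ultimately show ?thesis by blast
qed

end
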